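(* Let $G=\mathrm{Aut}(\mathbb{Q})$ be the group of order-preserving bijections of $\mathbb{Q}$, with the topology of pointwise convergence. Then every two-dimensional topological similarity class is meager in $G\times G$; that is, for every pair $(f_1,g_1)\in G\times G$, the set of pairs $(f,g)\in G\times G$ that are topologically similar to $(f_1,g_1)$ is meager in $G\times G$.
   Context: $\mathbb{Q}$ is the set of rationals with its usual linear order. The topology on $G=\mathrm{Aut}(\mathbb{Q})$ has as basic open sets $U(p)=\{g\in G: g \text{ extends } p\}$, where $p$ ranges over order-preserving bijections between finite subsets of $\mathbb{Q}$. For a topological group $K$, a pair $(g_1,g_2)\in K^2$ is topologically similar to $(f_1,f_2)\in K^2$ if the map $g_i\mapsto f_i$ ($i=1,2$) extends to a group isomorphism $\langle g_1,g_2\rangle\to\langle f_1,f_2\rangle$ that is a homeomorphism with respect to the subspace topologies. This is an equivalence relation; its classes are the two-dimensional topological similarity classes. *)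

theory Defs
  imports "HOL-Analysis.Analysis" "HOL-Algebra.Generated_Groups"
begin

definition AutQ :: "(rat \<Rightarrow> rat) set" where
  "AutQ = {f. bij f \<and> strict_mono f}"

definition AutQ_group :: "(rat \<Rightarrow> rat) monoid" where
  "AutQ_group = \<lparr>carrier = AutQ, mult = (\<circ>), one = id\<rparr>"

definition finite_partial_iso :: "(rat \<times> rat) set \<Rightarrow> bool" where
  "finite_partial_iso p \<longleftrightarrow> finite p \<and>
     (\<forall>(a,b)\<in>p. \<forall>(c,d)\<in>p. a < c \<longleftrightarrow> b < d)"

definition basic_open :: "(rat \<times> rat) set \<Rightarrow> (rat \<Rightarrow> rat) set" where
  "basic_open p = {g \<in> AutQ. \<forall>(a,b)\<in>p. g a = b}"

definition AutQ_top :: "(rat \<Rightarrow> rat) topology" where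
  "AutQ_top = topology_generated_by {basic_open p | p. finite_partial_iso p}"

definition top_similar :: "(rat \<Rightarrow> rat) \<times> (rat \<Rightarrow> rat) \<Rightarrow> (rat \<Rightarrow> rat) \<times> (rat \<Rightarrow> rat) \<Rightarrow> bool" where
  "top_similar gg ff \<longleftrightarrow>
     (let H1 = generate AutQ_group {fst gg, snd gg};
          H2 = generate AutQ_group {fst ff, snd ff}
      in \<exists>\<phi>. \<phi> \<in> iso (AutQ_group\<lparr>carrier := H1\<rparr>) (AutQ_group\<lparr>carrier := H2\<rparr>)
             \<and> \<phi> (fst gg) = fst ff \<and> \<phi> (snd gg) = snd ff
             \<and> homeomorphic_map (subtopology AutQ_top H1) (subtopology AutQ_top H2) \<phi>)"

definition nowhere_dense_in :: "'a topology \<Rightarrow> 'a set \<Rightarrow> bool" where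
  "nowhere_dense_in X S \<longleftrightarrow> S \<subseteq> topspace X \<and> X interior_of (X closure_of S) = {}"

definition meager_in :: "'a topology \<Rightarrow> 'a set \<Rightarrow> bool" where
  "meager_in X S \<longleftrightarrow> S \<subseteq> topspace X \<and>
     (\<exists>\<F>. countable \<F> \<and> (\<forall>N\<in>\<F>. nowhere_dense_in X N) \<and> S \<subseteq> \<Union>\<F>)"

end

theory Submission
  imports Defs
begin

text \<open>
  Let \<open>x\<close> be moved by \<open>f1\<close> or \<open>g1\<close>. A pair similar to \<open>(f1, g1)\<close> has a finite set \<open>F\<close> such that
  every word acting trivially on \<open>F\<close> at that pair fixes \<open>x\<close> at \<open>(f1, g1)\<close>; it suffices that
  for each fixed \<open>F\<close> the pairs with this property are nowhere dense.

  Given finitely many prescribed values of a pair, let \<open>C\<close> be the set of the prescribed common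
  fixed points. Choose \<open>f\<close> piecewise affine with finitely many fixed points and moving points up
  on both sides of every point of \<open>C\<close>, and let \<open>g\<close> move the fixed points of \<open>f\<close> outside \<open>C\<close>. Then
  some word \<open>w\<close> moves all of \<open>F - C\<close> at once above every argument and value of \<open>g\<close> prescribed so far
  or used in evaluating \<open>w\<close> on \<open>F\<close>, within the respective components of the complement of \<open>C\<close>. There
  \<open>g\<close> is still free: it may be redefined either to fix \<open>w(F)\<close> pointwise, or to map \<open>f(w(F))\<close> back to
  \<open>w(F)\<close> as the inverse of \<open>f\<close>. So both \<open>w\<inverse> g w\<close> and \<open>w\<inverse> g f w\<close> can be made trivial on \<open>F\<close>.
  If both of them fixed \<open>x\<close> at \<open>(f1, g1)\<close>, then \<open>w x\<close> and hence \<open>x\<close> would be fixed by \<open>f1\<close> and \<open>g1\<close>.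
\<close>

section \<open>Order automorphisms of the rationals and gaps of finite sets\<close>

lemma AutQ_I:
  assumes "\<And>x y. x < y \<Longrightarrow> f x < f y" and "\<And>y. \<exists>x. f x = y"
  shows "f \<in> AutQ"
proof -
  have "strict_mono f" using assms(1) by (simp add: strict_mono_def)
  moreover have "surj f" using assms(2) by (metis surjI)
  ultimately show ?thesis
    by (auto simp: AutQ_def bij_def intro: strict_mono_imp_inj_on)
qed

lemma AutQ_less [simp]: "f \<in> AutQ \<Longrightarrow> f x < f y \<longleftrightarrow> x < y"
  by (simp add: AutQ_def strict_mono_less)

lemma AutQ_le [simp]: "f \<in> AutQ \<Longrightarrow> f x \<le> f y \<longleftrightarrow> x \<le> y"
  by (simp add: AutQ_def strict_mono_less_eq)

lemma AutQ_eq [simp]: "f \<in> AutQ \<Longrightarrow> f x = f y \<longleftrightarrow> x = y"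
  by (simp add: AutQ_def strict_mono_eq)

abbreviation qinv :: "(rat \<Rightarrow> rat) \<Rightarrow> rat \<Rightarrow> rat" where
  "qinv \<equiv> inv_into UNIV"

lemma AutQ_f_inv [simp]: "f \<in> AutQ \<Longrightarrow> f (qinv f y) = y"
  by (simp add: AutQ_def bij_def surj_f_inv_f)

lemma AutQ_inv_f [simp]: "f \<in> AutQ \<Longrightarrow> qinv f (f y) = y"
  by (simp add: AutQ_def bij_def)

lemma AutQ_id: "id \<in> AutQ"
  by (rule AutQ_I) auto

lemma AutQ_comp: "f \<in> AutQ \<Longrightarrow> g \<in> AutQ \<Longrightarrow> f \<circ> g \<in> AutQ"
  by (rule AutQ_I) (auto intro: exI[of _ "qinv g (qinv f _)"])

lemma AutQ_inv: "f \<in> AutQ \<Longrightarrow> qinv f \<in> AutQ"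
proof (rule AutQ_I)
  assume f: "f \<in> AutQ"
  show "qinv f x < qinv f y" if "x < y" for x y
    using that f AutQ_less[OF f, of "qinv f x" "qinv f y"] by simp
  show "\<exists>x. qinv f x = y" for y
    using f by (intro exI[of _ "f y"]) simp
qed

lemma AutQ_glue:
  assumes f: "f \<in> AutQ" and h: "h \<in> AutQ" and eq: "f a = h a"
  shows "(\<lambda>x. if x \<le> a then f x else h x) \<in> AutQ"
proof (rule AutQ_I)
  fix x y :: rat
  assume "x < y"
  moreover have "f x < h y" if "x \<le> a" "a < y"
    using that f h eq by (metis AutQ_le AutQ_less le_less_trans)
  ultimately show "(if x \<le> a then f x else h x) < (if y \<le> a then f y else h y)"
    using f h by auto
next
  fix y
  show "\<exists>x. (if x \<le> a then f x else h x) = y"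
  proof (cases "y \<le> f a")
    case True
    then have "qinv f y \<le> a" using f AutQ_le[OF f, of "qinv f y" a] by simp
    then show ?thesis using f by (intro exI[of _ "qinv f y"]) auto
  next
    case False
    then have "\<not> qinv h y \<le> a" using h eq AutQ_le[OF h, of "qinv h y" a] by simp
    then show ?thesis using h by (intro exI[of _ "qinv h y"]) auto
  qed
qed

lemma finite_gap_above:
  fixes z :: rat
  assumes "finite A"
  shows "\<exists>e>z. \<forall>a\<in>A. z < a \<longrightarrow> e < a"
  using assms
proof (induction A rule: finite_induct)
  case empty
  show ?case using gt_ex[of z] by auto
next
  case (insert a A)
  then obtain e where e: "e > z" "\<forall>a\<in>A. z < a \<longrightarrow> e < a" by auto
  show ?case
  proof (cases "z < a")
    case True
    then obtain e' where "z < e'" "e' < min e a" using e dense[of z "min e a"] by auto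
    then show ?thesis using e by (intro exI[of _ e']) auto
  next
    case False
    then show ?thesis using e by auto
  qed
qed

lemma finite_gap_below:
  fixes z :: rat
  assumes "finite A"
  shows "\<exists>e<z. \<forall>a\<in>A. a < z \<longrightarrow> a < e"
proof -
  obtain e where "e > -z" "\<forall>a\<in>uminus ` A. -z < a \<longrightarrow> e < a"
    using finite_gap_above[of "uminus ` A" "-z"] assms by auto
  then show ?thesis by (intro exI[of _ "-e"]) auto
qed

section \<open>Piecewise affine automorphisms\<close>

text \<open>Over the rationals the absence of fixed points in an interval is not enough: orbits may
  converge to an irrational limit. A displacement of constant sign bounded away from 0 excludes
  this.\<close>

definition drift :: "(rat \<Rightarrow> rat) \<Rightarrow> rat \<Rightarrow> rat \<Rightarrow> bool" where
  "drift f x y \<longleftrightarrow>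
     (\<exists>\<delta>>0. (\<forall>t\<in>{x..y}. t + \<delta> \<le> f t) \<or> (\<forall>t\<in>{x..y}. f t + \<delta> \<le> t))"

text \<open>\<open>Z\<close> absorbs fixed points and break points. The intervals stay strictly
  inside \<open>(a, b)\<close>, since the displacement may tend to 0 at a fixed end point.\<close>

definition tame :: "(rat \<Rightarrow> rat) \<Rightarrow> rat \<Rightarrow> rat \<Rightarrow> bool" where
  "tame f a b \<longleftrightarrow>
     (\<exists>Z. finite Z \<and> (\<forall>x y. a < x \<and> y < b \<and> {x..y} \<inter> Z = {} \<longrightarrow> drift f x y))"

text \<open>Upward motion is asked on both sides: next to a fixed \<open>d\<close>, points move
  towards \<open>d\<close> on its left (\<open>push_left\<close>) and away from \<open>d\<close> on
  its right.\<close>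

definition push_right :: "(rat \<Rightarrow> rat) \<Rightarrow> rat \<Rightarrow> bool" where
  "push_right f d \<longleftrightarrow> (\<exists>e>d. \<forall>x. d < x \<and> x < e \<longrightarrow> x < f x)"

definition push_left :: "(rat \<Rightarrow> rat) \<Rightarrow> rat \<Rightarrow> bool" where
  "push_left f d \<longleftrightarrow> (\<exists>e<d. \<forall>x. e < x \<and> x < d \<longrightarrow> x < f x)"

lemma drift_cong: "(\<And>t. x \<le> t \<Longrightarrow> t \<le> y \<Longrightarrow> f t = g t) \<Longrightarrow> drift f x y \<Longrightarrow> drift g x y"
  unfolding drift_def by force

text \<open>The break \<open>m\<close> becomes exceptional. A nonempty interval missing it lies on
  one side, where the glued map is \<open>f\<close> or \<open>h\<close>.\<close>

lemma tame_glue: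
  assumes "tame f a m" and "tame h m b"
  shows "tame (\<lambda>x. if x \<le> m then f x else h x) a b"
proof -
  obtain Z where Z: "finite Z" "\<And>x y. a < x \<Longrightarrow> y < m \<Longrightarrow> {x..y} \<inter> Z = {} \<Longrightarrow> drift f x y"
    using assms(1) by (auto simp: tame_def)
  obtain Z' where Z': "finite Z'" "\<And>x y. m < x \<Longrightarrow> y < b \<Longrightarrow> {x..y} \<inter> Z' = {} \<Longrightarrow> drift h x y"
    using assms(2) by (auto simp: tame_def)
  have "drift (\<lambda>x. if x \<le> m then f x else h x) x y"
    if "a < x" "y < b" "{x..y} \<inter> insert m (Z \<union> Z') = {}" for x y
  proof -
    have "m \<notin> {x..y}" using that by auto
    then consider "y < x" | "x \<le> y" "y < m" | "m < x" by force
    then show ?thesis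
    proof cases
      case 1
      then show ?thesis by (auto simp: drift_def intro: exI[of _ 1])
    next
      case 2
      then have "drift f x y" using that Z(2) by blast
      then show ?thesis by (rule drift_cong[rotated]) (use 2 in auto)
    next
      case 3
      then have "drift h x y" using that Z'(2) by blast
      then show ?thesis by (rule drift_cong[rotated]) (use 3 in auto)
    qed
  qed
  then show ?thesis unfolding tame_def
    using Z(1) Z'(1) by (intro exI[of _ "insert m (Z \<union> Z')"]) auto
qed

text \<open>The affine map through the two given points has rational coefficients and is not the
  identity. Its displacement is affine with at most one zero, and a sign change can only happen at a
  rational point. On an interval without zero the displacement is therefore bounded away from 0 by
  its values at the ends.\<close>

lemma affine_piece:
  fixes a a' b b' :: rat
  assumes "a < a'" and "b < b'" and ne: "\<not> (a = b \<and> a' = b')"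
  obtains h where "h \<in> AutQ" and "h a = b" and "h a' = b'" and "tame h a a'"
    and "\<And>x. a \<le> b \<Longrightarrow> a' \<le> b' \<Longrightarrow> a < x \<Longrightarrow> x < a' \<Longrightarrow> x < h x"
proof -
  define k where "k = (b' - b) / (a' - a)"
  define m where "m = b - k * a"
  define h where "h x = k * x + m" for x
  have k: "k > 0" using assms by (simp add: k_def)
  have ka: "k * (a' - a) = b' - b" using assms by (simp add: k_def)
  have ha: "h a = b" by (simp add: h_def m_def)
  have ha': "h a' = b'" using ka by (simp add: h_def m_def algebra_simps)
  have aut: "h \<in> AutQ"
  proof (rule AutQ_I)
    show "\<exists>x. h x = y" for y
      using k by (intro exI[of _ "(y - m) / k"]) (simp add: h_def)
  qed (use k in \<open>simp add: h_def\<close>)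
  have k1: "k \<noteq> 1 \<or> m \<noteq> 0" using ne ha ha' by (auto simp: h_def)
  have fin: "finite {t. h t = t}"
  proof -
    have "t = m / (1 - k)" if "h t = t" for t
    proof -
      have "t * (1 - k) = m" using that by (simp add: h_def algebra_simps)
      moreover have "k \<noteq> 1" using calculation k1 by auto
      ultimately show ?thesis by (simp add: field_simps)
    qed
    then have "{t. h t = t} \<subseteq> {m / (1 - k)}" by auto
    then show ?thesis using finite_subset by blast
  qed
  have dr: "drift h x y" if no: "{x..y} \<inter> {t. h t = t} = {}" for x y
  proof (cases "x \<le> y")
    case False
    then show ?thesis by (auto simp: drift_def intro: exI[of _ 1])
  next
    case True
    define d where "d t = h t - t" for t
    have d: "d t = (k - 1) * t + m" for t by (simp add: d_def h_def algebra_simps)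
    have mono: "min (d x) (d y) \<le> d t" "d t \<le> max (d x) (d y)" if "x \<le> t" "t \<le> y" for t
    proof -
      have "d x \<le> d t \<and> d t \<le> d y" if "k \<ge> 1"
        using that \<open>x \<le> t\<close> \<open>t \<le> y\<close> unfolding d by (simp add: mult_left_mono)
      moreover have "d y \<le> d t \<and> d t \<le> d x" if "k \<le> 1"
        using that \<open>x \<le> t\<close> \<open>t \<le> y\<close> unfolding d by (simp add: mult_left_mono_neg)
      ultimately show "min (d x) (d y) \<le> d t" "d t \<le> max (d x) (d y)"
        by (meson linorder_linear min.coboundedI1 min.coboundedI2 max.coboundedI1 max.coboundedI2)+
    qed
    have nz: "d t \<noteq> 0" if "x \<le> t" "t \<le> y" for t using no that by (auto simp: d_def)
    have same: "\<not> (d x < 0 \<and> d y > 0)" "\<not> (d x > 0 \<and> d y < 0)"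
    proof -
      \<comment> \<open>The zero of the displacement, found by linear interpolation; it lies between
        \<open>x\<close> and \<open>y\<close> when the signs there are opposite.\<close>
      define t where "t = x + (y - x) * (d x / (d x - d y))"
      have t0: "d t = 0" if "d x \<noteq> d y"
      proof -
        have "d t = d x + ((k - 1) * (y - x)) * (d x / (d x - d y))"
          unfolding t_def d by (simp add: algebra_simps)
        also have "(k - 1) * (y - x) = d y - d x" unfolding d by (simp add: algebra_simps)
        also have "d x + (d y - d x) * (d x / (d x - d y)) = 0"
          using that by (simp add: field_simps)
        finally show ?thesis .
      qed
      have "x \<le> t \<and> t \<le> y" if "0 \<le> d x / (d x - d y)" "d x / (d x - d y) \<le> 1"
        using that True mult_left_le[of "d x / (d x - d y)" "y - x"]
          mult_nonneg_nonneg[of "y - x" "d x / (d x - d y)"] by (auto simp: t_def)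
      then show "\<not> (d x < 0 \<and> d y > 0)" "\<not> (d x > 0 \<and> d y < 0)"
        using t0 nz by (force simp: divide_simps)+
    qed
    show ?thesis
    proof (cases "d x > 0")
      case True
      then have "d y > 0" using same nz[of y] \<open>x \<le> y\<close> by force
      then show ?thesis unfolding drift_def using True mono(1)
        by (intro exI[of _ "min (d x) (d y)"]) (force simp: d_def)
    next
      case False
      then have "d x < 0" using nz[of x] \<open>x \<le> y\<close> by force
      then have "d y < 0" using same nz[of y] \<open>x \<le> y\<close> by force
      then show ?thesis unfolding drift_def using \<open>d x < 0\<close> mono(2)
        by (intro exI[of _ "- max (d x) (d y)"]) (force simp: d_def)
    qed
  qed
  have up: "x < h x" if "a \<le> b" "a' \<le> b'" "a < x" "x < a'" for x
  proof -
    \<comment> \<open>Up to the factor \<open>a' - a\<close>, the displacement at \<open>x\<close>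
      is a convex combination of those at \<open>a\<close> and \<open>a'\<close>, which are
      nonnegative and not both 0.\<close>
    have "(h x - x) * (a' - a) = (b - a) * (a' - x) + (b' - a') * (x - a)"
      unfolding ha[symmetric] ha'[symmetric] h_def by (simp add: algebra_simps)
    also have "\<dots> > 0"
    proof (cases "a < b")
      case True
      then show ?thesis using that by (simp add: add_pos_nonneg)
    next
      case False
      then have "a' < b'" using that ne by auto
      then show ?thesis using that by (simp add: add_nonneg_pos)
    qed
    finally show ?thesis using assms(1) by (simp add: zero_less_mult_iff)
  qed
  show thesis
    by (rule that[of h]) (use aut ha ha' up fin dr in \<open>auto simp: tame_def\<close>)
qed

text \<open>An end point that is fixed is split off by an affine piece lying above the diagonal.\<close>

lemma tame_piece:
  fixes a a' b b' :: rat
  assumes "a < a'" and "b < b'"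
  obtains h where "h \<in> AutQ" and "h a = b" and "h a' = b'" and "tame h a a'"
    and "a = b \<Longrightarrow> push_right h a" and "a' = b' \<Longrightarrow> push_left h a'"
proof (cases "a = b \<or> a' = b'")
  case False
  then show thesis using affine_piece[OF assms] that by metis
next
  case True
  then have "a < min a' b'" using assms by auto
  \<comment> \<open>Taking \<open>m\<close> below \<open>b'\<close> leaves room for \<open>n\<close>
    with \<open>m < n < b'\<close>, so the break point \<open>(m, n)\<close> lies strictly above the
    diagonal.\<close>
  then obtain m where m: "a < m" "m < a'" "m < b'" using dense[of a "min a' b'"] by auto
  then obtain n where n: "m < n" "b < n" "n < b'" using dense[of "max m b" b'] assms by auto
  obtain h where h: "h \<in> AutQ" "h a = b" "h m = n" "tame h a m"
      "\<And>x. a \<le> b \<Longrightarrow> m \<le> n \<Longrightarrow> a < x \<Longrightarrow> x < m \<Longrightarrow> x < h x"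
    using affine_piece[of a m b n] m n by blast
  obtain h' where h': "h' \<in> AutQ" "h' m = n" "h' a' = b'" "tame h' m a'"
      "\<And>x. m \<le> n \<Longrightarrow> a' \<le> b' \<Longrightarrow> m < x \<Longrightarrow> x < a' \<Longrightarrow> x < h' x"
    using affine_piece[of m a' n b'] m n by blast
  let ?h = "\<lambda>x. if x \<le> m then h x else h' x"
  show thesis
  proof (rule that[of ?h])
    show "?h \<in> AutQ" using h h' by (intro AutQ_glue) auto
    show "tame ?h a a'" using h h' by (intro tame_glue) auto
    show "push_right ?h a" if "a = b"
      using h(5) that m n by (auto simp: push_right_def intro!: exI[of _ m])
    show "push_left ?h a'" if "a' = b'"
      using h'(5) that m n by (auto simp: push_left_def intro!: exI[of _ m])
  qed (use m h h' in auto)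
qed

section \<open>Extending finite partial automorphisms with control of fixed points\<close>

lemma push_right_cong:
  assumes "push_right f d" and "d < e" and "\<And>x. d < x \<Longrightarrow> x < e \<Longrightarrow> f x = g x"
  shows "push_right g d"
proof -
  obtain e' where "e' > d" "\<forall>x. d < x \<and> x < e' \<longrightarrow> x < f x"
    using assms(1) by (auto simp: push_right_def)
  then show ?thesis unfolding push_right_def
    using assms(2,3) by (intro exI[of _ "min e e'"]) auto
qed

lemma push_left_cong:
  assumes "push_left f d" and "e < d" and "\<And>x. e < x \<Longrightarrow> x < d \<Longrightarrow> f x = g x"
  shows "push_left g d"
proof -
  obtain e' where "e' < d" "\<forall>x. e' < x \<and> x < d \<longrightarrow> x < f x"
    using assms(1) by (auto simp: push_left_def)
  then show ?thesis unfolding push_left_def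
    using assms(2,3) by (intro exI[of _ "max e e'"]) auto
qed

text \<open>Induction on \<open>D\<close> by adding a new maximum \<open>a\<close>: a tame piece
  over the gap is glued at the former maximum \<open>m\<close>. At \<open>m\<close> the left side is
  inherited and the right side comes from the new piece, which is why nothing is claimed on the
  outer sides of \<open>Min D\<close> and \<open>Max D\<close>.\<close>

lemma tame_extension:
  fixes D :: "rat set"
  assumes "finite D" and "D \<noteq> {}" and "strict_mono_on D \<phi>"
  shows "\<exists>f\<in>AutQ. (\<forall>d\<in>D. f d = \<phi> d) \<and> tame f (Min D) (Max D) \<and>
    (\<forall>d\<in>D. \<phi> d = d \<longrightarrow> (d < Max D \<longrightarrow> push_right f d) \<and> (Min D < d \<longrightarrow> push_left f d))"
  using assms
proof (induction D rule: finite_linorder_max_induct)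
  case empty
  then show ?case by simp
next
  case (insert a D)
  show ?case
  proof (cases "D = {}")
    case True
    have "(\<lambda>x. x + (\<phi> a - a)) \<in> AutQ"
      by (rule AutQ_I) (auto intro: exI[of _ "_ - (\<phi> a - a)"])
    \<comment> \<open>If \<open>a < x\<close> and \<open>y < a\<close>, then \<open>{x..y}\<close>
      is empty and any \<open>\<delta>\<close> will do.\<close>
    moreover have "tame f a a" for f
      unfolding tame_def drift_def by (intro exI[of _ "{}"]) (auto intro: exI[of _ 1])
    ultimately show ?thesis using True by (intro bexI[of _ "\<lambda>x. x + (\<phi> a - a)"]) auto
  next
    case False
    define m where "m = Max D"
    have mD: "m \<in> D" "\<And>d. d \<in> D \<Longrightarrow> d \<le> m" using insert.hyps False by (auto simp: m_def)
    have ma: "m < a" using insert.hyps mD by auto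
    have Mx: "Max (insert a D) = a"
      using insert.hyps by (intro Max_eqI) auto
    have "Min D \<le> a" using insert.hyps mD ma by (meson Min_le less_imp_le order_trans)
    then have Mn: "Min (insert a D) = Min D"
      using insert.hyps False by (simp add: min_absorb2)
    have lt: "\<phi> m < \<phi> a" using insert.prems ma mD by (auto simp: strict_mono_on_def)
    have "strict_mono_on D \<phi>" using insert.prems by (auto simp: strict_mono_on_def)
    then obtain f where f: "f \<in> AutQ" "\<And>d. d \<in> D \<Longrightarrow> f d = \<phi> d" "tame f (Min D) m"
      "\<And>d. d \<in> D \<Longrightarrow> \<phi> d = d \<Longrightarrow> d < m \<Longrightarrow> push_right f d"
      "\<And>d. d \<in> D \<Longrightarrow> \<phi> d = d \<Longrightarrow> Min D < d \<Longrightarrow> push_left f d"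
      using insert.IH False unfolding m_def by blast
    obtain h where h: "h \<in> AutQ" "h m = \<phi> m" "h a = \<phi> a" "tame h m a"
      "m = \<phi> m \<Longrightarrow> push_right h m" "a = \<phi> a \<Longrightarrow> push_left h a"
      using tame_piece[OF ma lt] by blast
    let ?f = "\<lambda>x. if x \<le> m then f x else h x"
    have "?f \<in> AutQ" using f h mD by (intro AutQ_glue) auto
    moreover have "?f d = \<phi> d" if "d \<in> insert a D" for d
      using that f h mD ma by auto
    moreover have "tame ?f (Min D) a" using f h by (intro tame_glue) auto
    moreover have "push_right ?f d" if "d \<in> insert a D" "\<phi> d = d" "d < a" for d
    proof (cases "d = m")
      case True
      then show ?thesis using push_right_cong[of h m a ?f] h that by auto
    next
      case False
      then have "d \<in> D" "d < m" using that mD(2)[of d] by auto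
      then show ?thesis using push_right_cong[of f d m ?f] f that by auto
    qed
    moreover have "push_left ?f d" if "d \<in> insert a D" "\<phi> d = d" "Min D < d" for d
    proof (cases "d = a")
      case True
      then show ?thesis using push_left_cong[of h a m ?f] h that ma by auto
    next
      case False
      then have "d \<in> D" "d \<le> m" using that mD(2)[of d] by auto
      then show ?thesis using push_left_cong[of f d "d - 1" ?f] f that by auto
    qed
    ultimately show ?thesis unfolding Mx Mn by (intro bexI[of _ ?f]) blast+
  qed
qed

lemma AutQ_extension:
  fixes D :: "rat set"
  assumes "finite D" and "strict_mono_on D \<phi>"
  obtains f where "f \<in> AutQ" and "\<And>d. d \<in> D \<Longrightarrow> f d = \<phi> d"
proof (cases "D = {}")
  case True
  then show thesis using that AutQ_id by blast
next
  case False
  then show thesis using tame_extension[OF assms(1) _ assms(2)] that by blast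
qed

text \<open>The value at \<open>z\<close> is raised to \<open>g e\<close>, where \<open>e\<close>
  lies between \<open>z\<close> and the next point of \<open>A\<close>. This stays increasing on the
  finite set and can be extended.\<close>

lemma AutQ_perturb:
  assumes g: "g \<in> AutQ" and "finite A" and "z \<notin> A"
  obtains g' where "g' \<in> AutQ" and "\<And>a. a \<in> A \<Longrightarrow> g' a = g a" and "g' z \<noteq> g z"
proof -
  obtain e where e: "e > z" "\<forall>a\<in>A. z < a \<longrightarrow> e < a" using finite_gap_above assms by blast
  define \<phi> where "\<phi> = g(z := g e)"
  have "strict_mono_on (insert z A) \<phi>"
    unfolding strict_mono_on_def \<phi>_def using e g assms(3) by (auto intro: less_trans)
  then obtain g' where "g' \<in> AutQ" "\<And>d. d \<in> insert z A \<Longrightarrow> g' d = \<phi> d"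
    using AutQ_extension assms by (metis finite_insert)
  moreover have "g e \<noteq> g z" using g e by simp
  ultimately show thesis using that[of g'] assms(3) by (simp add: \<phi>_def split: if_splits) metis
qed

text \<open>The points of \<open>Z\<close> are treated one at a time; perturbing at \<open>z\<close>
  keeps the values on \<open>D\<close> and at the points moved before.\<close>

lemma AutQ_extension_moving:
  fixes D Z :: "rat set"
  assumes "finite D" and "strict_mono_on D \<phi>" and "finite Z" and "D \<inter> Z = {}"
  shows "\<exists>g\<in>AutQ. (\<forall>d\<in>D. g d = \<phi> d) \<and> (\<forall>z\<in>Z. g z \<noteq> z)"
  using assms(3,4)
proof (induction Z rule: finite_induct)
  case empty
  then show ?case using AutQ_extension assms by (metis empty_iff)
next
  case (insert z Z)
  then obtain g where g: "g \<in> AutQ" "\<forall>d\<in>D. g d = \<phi> d" "\<forall>z\<in>Z. g z \<noteq> z" by auto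
  show ?case
  proof (cases "g z = z")
    case True
    obtain g' where "g' \<in> AutQ" "\<And>a. a \<in> D \<union> Z \<Longrightarrow> g' a = g a" "g' z \<noteq> g z"
      using AutQ_perturb[OF g(1), of "D \<union> Z" z] insert assms(1) by auto
    then show ?thesis using g True by (intro bexI[of _ g']) auto
  next
    case False
    then show ?thesis using g by auto
  qed
qed

section \<open>Words in two automorphisms\<close>

text \<open>In a letter the first component selects the generator, the second one its sign.\<close>

type_synonym word = "(bool \<times> bool) list"

fun letter :: "(rat \<Rightarrow> rat) \<Rightarrow> (rat \<Rightarrow> rat) \<Rightarrow> bool \<times> bool \<Rightarrow> rat \<Rightarrow> rat" where
  "letter f g (b, s) = (let h = if b then f else g in if s then h else qinv h)"

primrec ev :: "(rat \<Rightarrow> rat) \<Rightarrow> (rat \<Rightarrow> rat) \<Rightarrow> word \<Rightarrow> rat \<Rightarrow> rat" where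
  "ev f g [] = id"
| "ev f g (l # w) = letter f g l \<circ> ev f g w"

definition word_inv :: "word \<Rightarrow> word" where
  "word_inv w = rev (map (\<lambda>(b, s). (b, \<not> s)) w)"

lemma letter_AutQ: "f \<in> AutQ \<Longrightarrow> g \<in> AutQ \<Longrightarrow> letter f g l \<in> AutQ"
  by (cases l) (auto simp: Let_def AutQ_inv)

lemma ev_AutQ: "f \<in> AutQ \<Longrightarrow> g \<in> AutQ \<Longrightarrow> ev f g w \<in> AutQ"
  by (induction w) (auto intro: AutQ_id AutQ_comp letter_AutQ simp del: letter.simps)

lemma ev_append: "ev f g (v @ w) x = ev f g v (ev f g w x)"
  by (induction v) auto

lemma ev_word_inv:
  assumes "f \<in> AutQ" and "g \<in> AutQ"
  shows "ev f g (word_inv w) (ev f g w x) = x"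
proof (induction w arbitrary: x)
  case Nil
  show ?case by (simp add: word_inv_def)
next
  case (Cons l w)
  obtain b s where "l = (b, s)" by fastforce
  then have "ev f g (word_inv (l # w)) y = ev f g (word_inv w) (letter f g (b, \<not> s) y)" for y
    by (simp add: word_inv_def ev_append del: letter.simps)
  moreover have "letter f g (b, \<not> s) (letter f g (b, s) y) = y" for y
    using assms by (auto simp: Let_def)
  ultimately show ?case using Cons \<open>l = (b, s)\<close> by (simp del: letter.simps)
qed

lemma ev_replicate: "ev f g (replicate n l) = letter f g l ^^ n"
  by (induction n) auto

lemma ev_fixed:
  assumes "f \<in> AutQ" "g \<in> AutQ" "f c = c" "g c = c"
  shows "ev f g w c = c"
proof (induction w)
  case (Cons l w)
  have "qinv f c = c" "qinv g c = c" using assms by (metis AutQ_inv_f)+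
  then have "letter f g l c = c" using assms by (cases l) (auto simp: Let_def)
  then show ?case using Cons by simp
qed simp

text \<open>Evaluating a word at a point reads finitely many values of the generators. An inverse
  letter at \<open>y\<close> reads the value at the preimage of \<open>y\<close>, so both preimages
  enter the set along with \<open>y\<close>.\<close>

lemma ev_support_point:
  assumes "f \<in> AutQ" "g \<in> AutQ"
  shows "\<exists>E. finite E \<and> (\<forall>f'\<in>AutQ. \<forall>g'\<in>AutQ. (\<forall>a\<in>E. f' a = f a \<and> g' a = g a)
           \<longrightarrow> ev f' g' w x = ev f g w x)"
proof (induction w)
  case (Cons l w)
  then obtain E where E: "finite E" "\<And>f' g'. f' \<in> AutQ \<Longrightarrow> g' \<in> AutQ \<Longrightarrow>
      (\<forall>a\<in>E. f' a = f a \<and> g' a = g a) \<Longrightarrow> ev f' g' w x = ev f g w x" by blast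
  let ?y = "ev f g w x"
  let ?E = "E \<union> {?y, qinv f ?y, qinv g ?y}"
  have qinv_eq: "qinv h' y = qinv h y"
    if "h \<in> AutQ" "h' \<in> AutQ" "h' (qinv h y) = h (qinv h y)" for h h' y
    using that by (metis AutQ_f_inv AutQ_inv_f)
  have "ev f' g' (l # w) x = ev f g (l # w) x"
    if "f' \<in> AutQ" "g' \<in> AutQ" "\<forall>a\<in>?E. f' a = f a \<and> g' a = g a" for f' g'
  proof -
    have "ev f' g' w x = ?y" using that E(2) by auto
    moreover have "letter f' g' l ?y = letter f g l ?y"
      using that assms qinv_eq[of f f' ?y] qinv_eq[of g g' ?y] by (cases l) (auto simp: Let_def)
    ultimately show ?thesis by simp
  qed
  then show ?case using E(1) by (intro exI[of _ ?E]) blast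
qed auto

lemma ev_support:
  assumes "f \<in> AutQ" "g \<in> AutQ" "finite F"
  obtains E where "finite E" and "\<And>f' g' x. f' \<in> AutQ \<Longrightarrow> g' \<in> AutQ \<Longrightarrow>
      (\<forall>a\<in>E. f' a = f a \<and> g' a = g a) \<Longrightarrow> x \<in> F \<Longrightarrow> ev f' g' w x = ev f g w x"
proof -
  obtain E where E: "\<And>x. finite (E x)" "\<And>x f' g'. f' \<in> AutQ \<Longrightarrow> g' \<in> AutQ \<Longrightarrow>
      (\<forall>a\<in>E x. f' a = f a \<and> g' a = g a) \<Longrightarrow> ev f' g' w x = ev f g w x"
    using ev_support_point[OF assms(1,2)] by metis
  show thesis
    by (rule that[of "\<Union>x\<in>F. E x"]) (use E assms(3) in auto)
qed

section \<open>Escaping upwards\<close>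

text \<open>As long as the orbit stays below \<open>y\<close>, each step gains at least
  \<open>\<delta>\<close>, which the Archimedean property bounds. The alternative
  \<open>y \<le> h t\<close> allows for a last step that leaves the interval; this is where an
  inverse map gives no estimate.\<close>

lemma iterate_escape:
  fixes h :: "rat \<Rightarrow> rat"
  assumes "\<delta> > 0" and step: "\<And>t. x \<le> t \<Longrightarrow> t \<le> y \<Longrightarrow> y \<le> h t \<or> t + \<delta> \<le> h t"
  shows "\<exists>k. y \<le> (h ^^ k) x"
proof (rule ccontr)
  assume "\<nexists>k. y \<le> (h ^^ k) x"
  then have lt: "(h ^^ k) x < y" for k by (metis not_le)
  have ge: "x + of_nat k * \<delta> \<le> (h ^^ k) x" for k
  proof (induction k)
    case (Suc k)
    have "0 \<le> of_nat k * \<delta>" using assms(1) by simp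
    then have "x \<le> (h ^^ k) x" using Suc by linarith
    then have "(h ^^ k) x + \<delta> \<le> (h ^^ Suc k) x"
      using step[of "(h ^^ k) x"] lt[of k] lt[of "Suc k"] by auto
    then show ?case using Suc by (simp add: algebra_simps)
  qed simp
  obtain k where "y - x < of_nat k * \<delta>"
    using ex_less_of_nat_mult assms(1) by blast
  then show False using ge[of k] lt[of k] by linarith
qed

lemma drift_escape:
  assumes f: "f \<in> AutQ" and "drift f x y"
  shows "\<exists>u. y \<le> ev f g u x"
proof -
  obtain \<delta> where \<delta>: "\<delta> > 0" and
    "(\<forall>t\<in>{x..y}. t + \<delta> \<le> f t) \<or> (\<forall>t\<in>{x..y}. f t + \<delta> \<le> t)"
    using assms(2) by (auto simp: drift_def)
  then consider "\<forall>t\<in>{x..y}. t + \<delta> \<le> f t" | "\<forall>t\<in>{x..y}. f t + \<delta> \<le> t" by blast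
  then show ?thesis
  proof cases
    case 1
    then obtain k where "y \<le> (f ^^ k) x" using iterate_escape[OF \<delta>, of x y f] by auto
    then show ?thesis by (intro exI[of _ "replicate k (True, True)"]) (simp add: ev_replicate)
  next
    case 2
    have "y \<le> qinv f t \<or> t + \<delta> \<le> qinv f t" if "x \<le> t" "t \<le> y" for t
    proof (cases "y \<le> qinv f t")
      case False
      \<comment> \<open>A preimage below \<open>x\<close> would give
        \<open>t < f x \<le> x - \<delta>\<close>, against \<open>x \<le> t\<close>.\<close>
      have "x \<le> qinv f t"
      proof (rule ccontr)
        assume "\<not> x \<le> qinv f t"
        then have "t < f x" using f AutQ_less[OF f, of "qinv f t" x] by simp
        moreover have "f x + \<delta> \<le> x" using 2 that by auto
        ultimately show False using that \<delta> by linarith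
      qed
      then have "f (qinv f t) + \<delta> \<le> qinv f t" using 2 False by auto
      then show ?thesis using f by simp
    qed simp
    then obtain k where "y \<le> (qinv f ^^ k) x" using iterate_escape[OF \<delta>, of x y "qinv f"] by auto
    then show ?thesis by (intro exI[of _ "replicate k (True, False)"]) (simp add: ev_replicate)
  qed
qed

lemma letter_moves_up:
  assumes "f \<in> AutQ" "g \<in> AutQ" "f z \<noteq> z \<or> g z \<noteq> z"
  obtains l where "z < letter f g l z"
proof -
  have inv_up: "z < qinv h z" if "h \<in> AutQ" "h z < z" for h
    using that AutQ_less[of h z "qinv h z"] by simp
  have "z < letter f g (True, True) z \<or> z < letter f g (True, False) z \<or>
        z < letter f g (False, True) z \<or> z < letter f g (False, False) z"
    using assms inv_up[of f] inv_up[of g] by (auto simp: neq_iff)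
  then show thesis using that by blast
qed

text \<open>Induction on the number of exceptional points between \<open>x\<close> and
  \<open>y\<close>. Let \<open>z\<close> be the largest: some letter carries a point
  \<open>t\<close> slightly below \<open>z\<close> over \<open>z\<close>. The induction hypothesis
  lifts \<open>x\<close> to \<open>t\<close>, the letter jumps over \<open>z\<close>, and drift
  covers the remaining way to \<open>y\<close>.\<close>

lemma escape:
  assumes f: "f \<in> AutQ" and g: "g \<in> AutQ" and "finite Z"
    and dr: "\<And>x y. lo < x \<Longrightarrow> y < hi \<Longrightarrow> {x..y} \<inter> Z = {} \<Longrightarrow> drift f x y"
    and mv: "\<And>z. z \<in> Z \<Longrightarrow> lo < z \<Longrightarrow> z < hi \<Longrightarrow> z \<notin> C \<Longrightarrow> f z \<noteq> z \<or> g z \<noteq> z"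
    and "lo < x" and "y < hi" and "{x..y} \<inter> C = {}"
  shows "\<exists>u. y \<le> ev f g u x"
  using assms(7,8)
proof (induction "card (Z \<inter> {x..y})" arbitrary: y rule: less_induct)
  case less
  show ?case
  proof (cases "Z \<inter> {x..y} = {}")
    case True
    then have "drift f x y" using dr less.prems assms(6) by blast
    then show ?thesis using drift_escape f by blast
  next
    case False
    define z where "z = Max (Z \<inter> {x..y})"
    have fin: "finite (Z \<inter> {x..y})" using assms(3) by simp
    have z: "z \<in> Z" "x \<le> z" "z \<le> y" using Max_in[OF fin False] by (auto simp: z_def)
    have zmax: "t \<le> z" if "t \<in> Z" "x \<le> t" "t \<le> y" for t
      unfolding z_def using that fin by (intro Max_ge) auto
    have "z \<notin> C" using z less.prems by auto
    then have "f z \<noteq> z \<or> g z \<noteq> z" using mv[of z] z less.prems assms(6) by auto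
    then obtain l where l: "z < letter f g l z" using letter_moves_up f g by blast
    let ?h = "letter f g l"
    have h: "?h \<in> AutQ" using letter_AutQ f g by blast
    \<comment> \<open>Every \<open>t\<close> between the preimage of \<open>z\<close> and
      \<open>z\<close> is carried over \<open>z\<close>.\<close>
    have "qinv ?h z < z" using l AutQ_less[OF h, of "qinv ?h z" z] h by simp
    then obtain t where t: "qinv ?h z < t" "t < z" using dense by blast
    have ht: "z < ?h t" using t AutQ_less[OF h, of "qinv ?h z" t] h by simp
    obtain u where u: "t \<le> ev f g u x"
    proof (cases "t \<le> x")
      case True
      then show thesis using that[of "[]"] by simp
    next
      case False
      have "z \<in> Z \<inter> {x..y}" "z \<notin> {x..t}" using z t by auto
      have "{x..t} \<subseteq> {x..y}" using z t by auto
      with \<open>z \<in> Z \<inter> {x..y}\<close> \<open>z \<notin> {x..t}\<close> have "Z \<inter> {x..t} \<subset> Z \<inter> {x..y}" by blast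
      then have "card (Z \<inter> {x..t}) < card (Z \<inter> {x..y})" using fin by (rule psubset_card_mono[rotated])
      moreover have "t < hi" using less.prems z t by auto
      moreover have "{x..t} \<inter> C = {}" using less.prems(2) \<open>{x..t} \<subseteq> {x..y}\<close> by blast
      ultimately show thesis using less.hyps that by blast
    qed
    have "\<exists>v. y \<le> ev f g v (?h t)"
    proof (cases "y \<le> ?h t")
      case True
      then show ?thesis by (intro exI[of _ "[]"]) simp
    next
      case False
      have "{?h t..y} \<inter> Z = {}" using zmax ht z by force
      then have "drift f (?h t) y" using dr less.prems assms(6) z ht by force
      then show ?thesis using drift_escape f by blast
    qed
    then obtain v where "y \<le> ev f g v (?h t)" by blast
    also have "\<dots> \<le> ev f g v (?h (ev f g u x))"
      using u h ev_AutQ[OF f g] by simp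
    also have "\<dots> = ev f g (v @ l # u) x" by (simp add: ev_append)
    finally show ?thesis by blast
  qed
qed

section \<open>Lifting finite sets simultaneously within the components of the complement of
  \<open>C\<close>\<close>

text \<open>\<open>esc\<close> lifts one point at a time and says nothing about the others.
  \<open>left\<close> and \<open>right\<close> make it possible to combine such lifts: powers of
  \<open>f\<close> bring points just below some \<open>c\<close> arbitrarily close to
  \<open>c\<close>, while points just above \<open>c\<close> do not sink back to it.\<close>

locale pushing_pair =
  fixes f g :: "rat \<Rightarrow> rat" and C :: "rat set" and lo hi :: rat
  assumes f: "f \<in> AutQ" and g: "g \<in> AutQ"
    and finC: "finite C" and lo: "lo \<in> C" and hi: "hi \<in> C"
    and fixC: "\<And>c. c \<in> C \<Longrightarrow> f c = c \<and> g c = c"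
    and esc: "\<And>x y. lo < x \<Longrightarrow> y < hi \<Longrightarrow> {x..y} \<inter> C = {} \<Longrightarrow> \<exists>u. y \<le> ev f g u x"
    and right: "\<And>c. c \<in> C \<Longrightarrow> c < hi \<Longrightarrow> push_right f c"
    and left: "\<And>c. c \<in> C \<Longrightarrow> lo < c \<Longrightarrow> \<exists>e<c. \<forall>t. e < t \<and> t < c \<longrightarrow>
          t < f t \<and> (\<forall>s<c. \<exists>k. s \<le> (f ^^ k) t)"
begin

text \<open>\<open>(e, c)\<close> is a left-sided basin of attraction of \<open>c\<close> under
  \<open>f\<close>; the points in such basins are called \<open>high\<close>.\<close>

definition below :: "rat \<Rightarrow> rat \<Rightarrow> bool" where
  "below e c \<longleftrightarrow> c \<in> C \<and> e < c \<and>
     (\<forall>t. e < t \<and> t < c \<longrightarrow> t < f t \<and> (\<forall>s<c. \<exists>k. s \<le> (f ^^ k) t))"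

definition high :: "rat \<Rightarrow> bool" where
  "high t \<longleftrightarrow> (\<exists>e c. below e c \<and> e < t \<and> t < c)"

lemma ev_C: "c \<in> C \<Longrightarrow> ev f g u c = c"
  using ev_fixed f g fixC by blast

lemma funpow_high:
  assumes "below e c" "e < t" "t < c"
  shows "e < (f ^^ k) t \<and> (f ^^ k) t < c"
proof (induction k)
  case (Suc k)
  have "(f ^^ k) t < f ((f ^^ k) t)" using Suc assms(1) by (auto simp: below_def)
  moreover have "f ((f ^^ k) t) < f c" using Suc f by simp
  moreover have "f c = c" using assms(1) fixC by (auto simp: below_def)
  ultimately show ?case using Suc by auto
qed (use assms in auto)

lemma eventually_high:
  assumes "below e c" "e < t" "t < c" "s < c"
  shows "eventually (\<lambda>k. s \<le> (f ^^ k) t) sequentially"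
proof -
  obtain k0 where k0: "s \<le> (f ^^ k0) t" using assms by (auto simp: below_def)
  have "s \<le> (f ^^ k) t" if "k \<ge> k0" for k
    using that
  proof (induction k rule: dec_induct)
    case (step k)
    have "(f ^^ k) t < f ((f ^^ k) t)"
      using funpow_high[OF assms(1-3), of k] assms(1) by (auto simp: below_def)
    then show ?case using step by auto
  qed (rule k0)
  then show ?thesis unfolding eventually_sequentially by blast
qed

text \<open>After the points of \<open>F\<close> have been lifted by \<open>u\<close>, a high power of \<open>f\<close> makes them immune to
  the word \<open>v\<close> that lifts \<open>x\<close>; since \<open>f\<close> pushes up next to the points of \<open>C\<close>, the power does not
  bring \<open>x\<close> below a fixed \<open>m\<close>, so that \<open>v\<close> can be chosen before the exponent.\<close>

lemma lift_to_high:
  assumes "finite F" and "F \<subseteq> {lo<..<hi} - C"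
  shows "\<exists>u. \<forall>x\<in>F. high (ev f g u x)"
  using assms
proof (induction F rule: finite_induct)
  case empty
  then show ?case by simp
next
  case (insert x F)
  then obtain u where u: "\<forall>x\<in>F. high (ev f g u x)" by auto
  define x' where "x' = ev f g u x"
  have U: "ev f g u \<in> AutQ" using ev_AutQ f g by blast
  have x': "lo < x'" "x' < hi" "x' \<notin> C"
  proof -
    show "lo < x'" using AutQ_less[OF U, of lo x] insert.prems ev_C[OF lo] by (simp add: x'_def)
    show "x' < hi" using AutQ_less[OF U, of x hi] insert.prems ev_C[OF hi] by (simp add: x'_def)
    show "x' \<notin> C" using AutQ_eq[OF U, of x x'] insert.prems ev_C[of x'] by (auto simp: x'_def)
  qed
  \<comment> \<open>\<open>c\<close> and \<open>d\<close> bound the component of the complement of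
    \<open>C\<close> that contains \<open>x'\<close>.\<close>
  define c where "c = Max {c \<in> C. c < x'}"
  have "c \<in> {c \<in> C. c < x'}" unfolding c_def using finC lo x' by (intro Max_in) auto
  then have c: "c \<in> C" "c < x'" by auto
  have cmax: "c' \<le> c" if "c' \<in> C" "c' < x'" for c'
    unfolding c_def using that finC by (intro Max_ge) auto
  define d where "d = Min {d \<in> C. x' < d}"
  have "d \<in> {d \<in> C. x' < d}" unfolding d_def using finC hi x' by (intro Min_in) auto
  then have d: "d \<in> C" "x' < d" by auto
  have dmin: "d \<le> c'" if "c' \<in> C" "x' < c'" for c'
    unfolding d_def using that finC by (intro Min_le) auto
  have lohi: "lo \<le> c" "d \<le> hi" using cmax dmin lo hi x' by auto
  obtain e where e: "e > c" "\<And>t. c < t \<Longrightarrow> t < e \<Longrightarrow> t < f t"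
    using right[of c] c x' by (auto simp: push_right_def)
  \<comment> \<open>\<open>m\<close> lies where \<open>f\<close> pushes up, so
    \<open>m < f m\<close> and no power of \<open>f\<close> takes \<open>x'\<close> below
    \<open>m\<close>.\<close>
  obtain m where m: "c < m" "m < e" "m < x'" using dense[of c "min e x'"] e c by auto
  have mk: "m \<le> (f ^^ k) x' \<and> (f ^^ k) x' < d" for k
  proof (induction k)
    case (Suc k)
    have "m < f m" using e m by auto
    also have "f m \<le> f ((f ^^ k) x')" using Suc f by simp
    finally show ?case using Suc f fixC[OF d(1)] AutQ_less[OF f, of "(f ^^ k) x'" d] by simp
  qed (use m d in auto)
  obtain e' where e': "below e' d"
    using left[OF d(1)] d x' unfolding below_def by force
  obtain y where y: "e' < y" "y < d" using e' dense[of e' d] by (auto simp: below_def)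
  have "{m..y} \<inter> C = {}"
  proof -
    have "t \<notin> C" if "m \<le> t" "t \<le> y" for t
      using cmax[of t] dmin[of t] that m y x' by (cases t x' rule: linorder_cases) auto
    then show ?thesis by auto
  qed
  then obtain v where v: "y \<le> ev f g v m" using esc[of m y] m y lohi by force
  have V: "ev f g v \<in> AutQ" using ev_AutQ f g by blast
  have high_x: "high (ev f g v ((f ^^ k) x'))" for k
  proof -
    have "ev f g v m \<le> ev f g v ((f ^^ k) x')" using mk V by simp
    moreover have "ev f g v ((f ^^ k) x') < ev f g v d" using mk V by simp
    ultimately show ?thesis unfolding high_def
      using e' y v ev_C[OF d(1)] by (intro exI[of _ e'] exI[of _ d]) auto
  qed
  have "eventually (\<lambda>k. high (ev f g v ((f ^^ k) (ev f g u z)))) sequentially" if "z \<in> F" for z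
  proof -
    obtain e c where ec: "below e c" "e < ev f g u z" "ev f g u z < c"
      using u \<open>z \<in> F\<close> by (auto simp: high_def)
    have "c \<in> C" using ec by (auto simp: below_def)
    obtain r where r: "e < r" "r < c" using ec by (meson dense less_trans)
    \<comment> \<open>\<open>v\<close> fixes \<open>c\<close>, so the preimage of \<open>r\<close>
      is still below \<open>c\<close>; a high power of \<open>f\<close> passes it, and
      \<open>v\<close> then cannot bring the point below \<open>r\<close>.\<close>
    have "qinv (ev f g v) r < c"
      using AutQ_less[OF V, of "qinv (ev f g v) r" c] r ev_C[OF \<open>c \<in> C\<close>] V by simp
    then have "eventually (\<lambda>k. qinv (ev f g v) r \<le> (f ^^ k) (ev f g u z)) sequentially"
      using eventually_high[OF ec] by blast
    then show ?thesis
    proof (rule eventually_mono)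
      fix k assume k: "qinv (ev f g v) r \<le> (f ^^ k) (ev f g u z)"
      have "r \<le> ev f g v ((f ^^ k) (ev f g u z))"
        using k AutQ_le[OF V, of "qinv (ev f g v) r"] V by simp
      moreover have "ev f g v ((f ^^ k) (ev f g u z)) < c"
        using funpow_high[OF ec, of k] AutQ_less[OF V, of _ c] ev_C[OF \<open>c \<in> C\<close>] by simp
      ultimately show "high (ev f g v ((f ^^ k) (ev f g u z)))"
        unfolding high_def using ec r by (intro exI[of _ e] exI[of _ c]) auto
    qed
  qed
  then have "eventually (\<lambda>k. \<forall>z\<in>F. high (ev f g v ((f ^^ k) (ev f g u z)))) sequentially"
    using insert.hyps by (simp add: eventually_ball_finite)
  then obtain k where "\<forall>z\<in>F. high (ev f g v ((f ^^ k) (ev f g u z)))"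
    using eventually_happens'[OF sequentially_bot] by blast
  then have "\<forall>z\<in>insert x F. high (ev f g (v @ replicate k (True, True) @ u) z)"
    using high_x by (auto simp: ev_append ev_replicate x'_def)
  then show ?case by blast
qed

text \<open>Once all points are high, a further power of \<open>f\<close> takes them past any finite
  set. These last letters read no value of \<open>g\<close>, so the set \<open>E'\<close> of
  relevant arguments depends on \<open>u\<close> alone and is fixed before the exponent is
  chosen.\<close>

lemma lift_above:
  assumes "finite F" and "F \<subseteq> {lo<..<hi} - C" and "finite E"
  obtains w E' where "finite E'" and "E \<subseteq> E'"
    and "\<And>g' x. g' \<in> AutQ \<Longrightarrow> (\<forall>a\<in>E'. g' a = g a) \<Longrightarrow> x \<in> F \<Longrightarrow> ev f g' w x = ev f g w x"
    and "\<And>x. x \<in> F \<Longrightarrow> \<exists>d\<in>C. ev f g w x < d \<and> f (ev f g w x) < d \<and> ev f g w x < f (ev f g w x) \<and>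
            (\<forall>a\<in>E' \<union> g ` E'. a < d \<longrightarrow> a < ev f g w x)"
proof -
  obtain u where u: "\<forall>x\<in>F. high (ev f g u x)" using lift_to_high assms by blast
  obtain E1 where E1: "finite E1" "\<And>f' g' x. f' \<in> AutQ \<Longrightarrow> g' \<in> AutQ \<Longrightarrow>
      (\<forall>a\<in>E1. f' a = f a \<and> g' a = g a) \<Longrightarrow> x \<in> F \<Longrightarrow> ev f' g' u x = ev f g u x"
    using ev_support[OF f g assms(1)] by blast
  define P where "P = (E \<union> E1) \<union> g ` (E \<union> E1)"
  have finP: "finite P" using E1 assms by (simp add: P_def)
  have "eventually (\<lambda>k. \<exists>d\<in>C. (f ^^ k) (ev f g u x) < d \<and> (f ^^ Suc k) (ev f g u x) < d \<and>
      (f ^^ k) (ev f g u x) < (f ^^ Suc k) (ev f g u x) \<and>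
      (\<forall>a\<in>P. a < d \<longrightarrow> a < (f ^^ k) (ev f g u x))) sequentially" if "x \<in> F" for x
  proof -
    obtain e d where ed: "below e d" "e < ev f g u x" "ev f g u x < d"
      using u \<open>x \<in> F\<close> by (auto simp: high_def)
    obtain s where s: "s < d" "\<forall>a\<in>P. a < d \<longrightarrow> a < s" using finite_gap_below[OF finP] by blast
    show ?thesis
    proof (rule eventually_mono[OF eventually_high[OF ed s(1)]])
      fix k assume "s \<le> (f ^^ k) (ev f g u x)"
      then have "\<forall>a\<in>P. a < d \<longrightarrow> a < (f ^^ k) (ev f g u x)" using s by auto
      moreover have "(f ^^ k) (ev f g u x) < (f ^^ Suc k) (ev f g u x)"
        using funpow_high[OF ed, of k] ed(1) by (auto simp: below_def)
      moreover have "d \<in> C" using ed(1) by (auto simp: below_def)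
      ultimately show "\<exists>d\<in>C. (f ^^ k) (ev f g u x) < d \<and> (f ^^ Suc k) (ev f g u x) < d \<and>
          (f ^^ k) (ev f g u x) < (f ^^ Suc k) (ev f g u x) \<and>
          (\<forall>a\<in>P. a < d \<longrightarrow> a < (f ^^ k) (ev f g u x))"
        using funpow_high[OF ed] by blast
    qed
  qed
  then have "eventually (\<lambda>k. \<forall>x\<in>F. \<exists>d\<in>C. (f ^^ k) (ev f g u x) < d \<and>
      (f ^^ Suc k) (ev f g u x) < d \<and> (f ^^ k) (ev f g u x) < (f ^^ Suc k) (ev f g u x) \<and>
      (\<forall>a\<in>P. a < d \<longrightarrow> a < (f ^^ k) (ev f g u x))) sequentially"
    using assms(1) by (intro eventually_ball_finite) auto
  then obtain k where k: "\<And>x. x \<in> F \<Longrightarrow> \<exists>d\<in>C. (f ^^ k) (ev f g u x) < d \<and>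
      (f ^^ Suc k) (ev f g u x) < d \<and> (f ^^ k) (ev f g u x) < (f ^^ Suc k) (ev f g u x) \<and>
      (\<forall>a\<in>P. a < d \<longrightarrow> a < (f ^^ k) (ev f g u x))"
    using eventually_happens'[OF sequentially_bot] by blast
  let ?w = "replicate k (True, True) @ u"
  have w: "ev f g' ?w x = (f ^^ k) (ev f g' u x)" for g' x
    by (simp add: ev_append ev_replicate)
  show thesis
  proof (rule that[of "E \<union> E1" ?w])
    show "ev f g' ?w x = ev f g ?w x"
      if "g' \<in> AutQ" "\<forall>a\<in>E \<union> E1. g' a = g a" "x \<in> F" for g' x
      using E1(2)[of f g' x] that f by (simp add: w)
    show "\<exists>d\<in>C. ev f g ?w x < d \<and> f (ev f g ?w x) < d \<and> ev f g ?w x < f (ev f g ?w x) \<and>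
            (\<forall>a\<in>(E \<union> E1) \<union> g ` (E \<union> E1). a < d \<longrightarrow> a < ev f g ?w x)" if "x \<in> F" for x
      using k[OF that] unfolding w P_def by simp
  qed (use E1 assms in auto)
qed

end

section \<open>Completing finite data to pairs with words trivial on a finite set\<close>

text \<open>\<open>f\<close> is the tame extension. An exceptional point of \<open>f\<close> outside
  the common fixed points is either in \<open>D\<close>, where one of the prescribed maps moves it,
  or outside \<open>D\<close>, where \<open>g\<close> is chosen to move it; hence
  \<open>escape\<close> applies.\<close>

lemma exists_pushing_pair:
  assumes "finite D" and lo: "lo \<in> D" and hi: "hi \<in> D"
    and bounds: "\<And>d. d \<in> D \<Longrightarrow> lo \<le> d \<and> d \<le> hi"
    and mf: "strict_mono_on D \<phi>" and mg: "strict_mono_on D \<psi>"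
    and fix_ends: "\<phi> lo = lo" "\<psi> lo = lo" "\<phi> hi = hi" "\<psi> hi = hi"
  obtains f g where "\<And>d. d \<in> D \<Longrightarrow> f d = \<phi> d" and "\<And>d. d \<in> D \<Longrightarrow> g d = \<psi> d"
    and "pushing_pair f g {c \<in> D. \<phi> c = c \<and> \<psi> c = c} lo hi"
proof -
  let ?C = "{c \<in> D. \<phi> c = c \<and> \<psi> c = c}"
  have Min: "Min D = lo" and Max: "Max D = hi"
    using assms(1) lo hi bounds by (auto intro!: Min_eqI Max_eqI)
  obtain f where f: "f \<in> AutQ" "\<And>d. d \<in> D \<Longrightarrow> f d = \<phi> d" "tame f lo hi"
      "\<And>d. d \<in> D \<Longrightarrow> \<phi> d = d \<Longrightarrow> d < hi \<Longrightarrow> push_right f d"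
      "\<And>d. d \<in> D \<Longrightarrow> \<phi> d = d \<Longrightarrow> lo < d \<Longrightarrow> push_left f d"
    using tame_extension[OF assms(1) _ mf] lo unfolding Min Max by blast
  obtain Z where Z: "finite Z"
      "\<And>x y. lo < x \<Longrightarrow> y < hi \<Longrightarrow> {x..y} \<inter> Z = {} \<Longrightarrow> drift f x y"
    using f(3) by (auto simp: tame_def)
  obtain g where g: "g \<in> AutQ" "\<And>d. d \<in> D \<Longrightarrow> g d = \<psi> d" "\<And>z. z \<in> Z - D \<Longrightarrow> g z \<noteq> z"
    using AutQ_extension_moving[OF assms(1) mg, of "Z - D"] Z(1) by auto
  have esc: "\<exists>u. y \<le> ev f g u x" if "lo < x" "y < hi" "{x..y} \<inter> ?C = {}" for x y
  proof (rule escape[OF f(1) g(1) Z _ that])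
    show "f z \<noteq> z \<or> g z \<noteq> z" if "z \<in> Z" "z \<notin> ?C" for z
      using that f(2) g(2,3) by (cases "z \<in> D") auto
  qed
  have left: "\<exists>e<c. \<forall>t. e < t \<and> t < c \<longrightarrow> t < f t \<and> (\<forall>s<c. \<exists>k. s \<le> (f ^^ k) t)"
    if c: "c \<in> ?C" "lo < c" for c
  proof -
    obtain e1 where e1: "e1 < c" "\<And>t. e1 < t \<Longrightarrow> t < c \<Longrightarrow> t < f t"
      using f(5)[of c] c by (auto simp: push_left_def)
    \<comment> \<open>Above \<open>e2\<close> no exceptional point is met before \<open>c\<close>,
      so drift holds there; the upward push next to \<open>c\<close> decides its sign.\<close>
    obtain e2 where e2: "e2 < c" "\<forall>a\<in>insert lo Z. a < c \<longrightarrow> a < e2"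
      using finite_gap_below[of "insert lo Z" c] Z(1) by blast
    have "\<exists>k. s \<le> (f ^^ k) t" if t: "max e1 e2 < t" "t < c" and s: "s < c" for s t
    proof (cases "t \<le> s")
      case False
      then show ?thesis by (intro exI[of _ 0]) auto
    next
      case True
      have "c \<le> hi" using bounds c by auto
      have "{t..s} \<inter> Z = {}"
      proof -
        have False if "a \<in> Z" "t \<le> a" "a \<le> s" for a
          using e2(2) that t s by force
        then show ?thesis by auto
      qed
      then have "drift f t s" using Z(2)[of t s] e2 c t s \<open>c \<le> hi\<close> by auto
      moreover have "t < f t" using e1 t by auto
      ultimately obtain \<delta> where \<delta>: "\<delta> > 0" "\<forall>r\<in>{t..s}. r + \<delta> \<le> f r"
        unfolding drift_def using True by force
      then show ?thesis using iterate_escape[of \<delta> t s f] by auto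
    qed
    then show ?thesis using e1 e2 by (intro exI[of _ "max e1 e2"]) auto
  qed
  show thesis
  proof (rule that[of f g])
    show "pushing_pair f g ?C lo hi"
      by unfold_locales (use f g assms(1) lo hi fix_ends esc left in auto)
  qed (use f g in auto)
qed

text \<open>\<open>E'\<close> contains all arguments at which \<open>w\<close> reads
  \<open>g\<close> on \<open>F - C\<close>, so redefining \<open>g\<close> outside \<open>E'\<close>
  does not change the lifted set \<open>Y\<close>. Points of \<open>F\<close> in \<open>C\<close>
  are fixed by everything.\<close>

lemma (in pushing_pair) two_liberations:
  assumes "finite E" and "C \<subseteq> E" and "finite F" and F: "F \<subseteq> {lo<..<hi}"
  obtains g' g'' w where "g' \<in> AutQ" and "g'' \<in> AutQ"
    and "\<And>a. a \<in> E \<Longrightarrow> g' a = g a" and "\<And>a. a \<in> E \<Longrightarrow> g'' a = g a"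
    and "\<And>x. x \<in> F \<Longrightarrow> g' (ev f g' w x) = ev f g' w x"
    and "\<And>x. x \<in> F \<Longrightarrow> g'' (f (ev f g'' w x)) = ev f g'' w x"
proof (rule lift_above[of "F - C" E])
  show "finite (F - C)" "F - C \<subseteq> {lo<..<hi} - C" "finite E" using assms by auto
next
  fix E' w
  assume E': "finite E'" "E \<subseteq> E'"
    and same: "\<And>g' x. g' \<in> AutQ \<Longrightarrow> (\<forall>a\<in>E'. g' a = g a) \<Longrightarrow> x \<in> F - C \<Longrightarrow> ev f g' w x = ev f g w x"
    and top: "\<And>x. x \<in> F - C \<Longrightarrow> \<exists>d\<in>C. ev f g w x < d \<and> f (ev f g w x) < d \<and>
            ev f g w x < f (ev f g w x) \<and> (\<forall>a\<in>E' \<union> g ` E'. a < d \<longrightarrow> a < ev f g w x)"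
  define Y where "Y = ev f g w ` (F - C)"
  have finY: "finite Y" using assms by (simp add: Y_def)
  \<comment> \<open>Arguments and values of \<open>g\<close> on \<open>E'\<close> lie below
    \<open>y\<close> or at least at \<open>d\<close>, whereas \<open>y\<close> and
    \<open>f y\<close> lie in between. Hence sending \<open>y\<close> to \<open>y\<close>, or
    \<open>f y\<close> to \<open>y\<close>, respects the order.\<close>
  have cut: "(a < y \<longrightarrow> g a < y) \<and> (y < a \<longrightarrow> y < g a) \<and> (a < f y \<longrightarrow> g a < y) \<and>
      (f y < a \<longrightarrow> y < g a) \<and> a \<noteq> y \<and> a \<noteq> f y"
    if y: "y \<in> Y" and a: "a \<in> E'" for a y
  proof -
    obtain d where d: "d \<in> C" "y < d" "f y < d" "y < f y" "\<And>a. a \<in> E' \<union> g ` E' \<Longrightarrow> a < d \<Longrightarrow> a < y"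
      using top y unfolding Y_def by blast
    have gd: "g d = d" using fixC d by blast
    show ?thesis
    proof (cases "a < d")
      case True
      then have "g a < d" using g gd AutQ_less[OF g, of a d] by simp
      then have "a < y" "g a < y" using d(5)[of a] d(5)[of "g a"] a True by auto
      then show ?thesis using d by auto
    next
      case False
      then have "d \<le> g a" using g gd AutQ_le[OF g, of d a] by simp
      then show ?thesis using d False by auto
    qed
  qed
  define \<phi> where "\<phi> a = (if a \<in> Y then a else g a)" for a
  have "strict_mono_on (E' \<union> Y) \<phi>"
    unfolding strict_mono_on_def \<phi>_def using cut g by auto
  then obtain g' where g': "g' \<in> AutQ" "\<And>a. a \<in> E' \<union> Y \<Longrightarrow> g' a = \<phi> a"
    using AutQ_extension[of "E' \<union> Y" \<phi>] E' finY by blast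
  have g'E: "g' a = g a" if "a \<in> E'" for a using g' that cut[of a a] by (auto simp: \<phi>_def)
  define \<psi> where "\<psi> a = (if a \<in> f ` Y then qinv f a else g a)" for a
  have "strict_mono_on (E' \<union> f ` Y) \<psi>"
    unfolding strict_mono_on_def \<psi>_def using cut g f by (auto simp: image_iff)
  then obtain g'' where g'': "g'' \<in> AutQ" "\<And>a. a \<in> E' \<union> f ` Y \<Longrightarrow> g'' a = \<psi> a"
    using AutQ_extension[of "E' \<union> f ` Y" \<psi>] E' finY by blast
  have g''E: "g'' a = g a" if "a \<in> E'" for a using g'' that cut[of _ a] by (auto simp: \<psi>_def)
  have CE: "g' c = c" "g'' c = c" if "c \<in> C" for c
    using that assms(2) E'(2) g'E g''E fixC by (metis subsetD)+
  show thesis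
  proof (rule that[of g' g'' w])
    fix x assume x: "x \<in> F"
    show "g' (ev f g' w x) = ev f g' w x"
    proof (cases "x \<in> C")
      case True
      then show ?thesis using CE fixC ev_fixed[OF f g'(1)] by metis
    next
      case False
      then have "ev f g' w x = ev f g w x" using same g' g'E x by blast
      moreover have "ev f g w x \<in> Y" using x False by (auto simp: Y_def)
      ultimately show ?thesis using g' by (auto simp: \<phi>_def)
    qed
    show "g'' (f (ev f g'' w x)) = ev f g'' w x"
    proof (cases "x \<in> C")
      case True
      then show ?thesis using CE fixC ev_fixed[OF f g''(1)] by metis
    next
      case False
      then have "ev f g'' w x = ev f g w x" using same g'' g''E x by blast
      moreover have "ev f g w x \<in> Y" using x False by (auto simp: Y_def)
      ultimately show ?thesis using g'' f by (auto simp: \<psi>_def)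
    qed
  qed (use g' g'' g'E g''E E'(2) in auto)
qed

text \<open>The word is a conjugate by \<open>w\<close> of \<open>g\<close> or of
  \<open>g f\<close>, according to which of the two moves the image of \<open>x\<close> under
  \<open>w\<close> at \<open>(f1, g1)\<close>.\<close>

lemma word_fixing_finite_set:
  assumes f0: "f0 \<in> AutQ" and g0: "g0 \<in> AutQ" and "finite E" and "finite F"
    and f1: "f1 \<in> AutQ" and g1: "g1 \<in> AutQ" and moved: "f1 x \<noteq> x \<or> g1 x \<noteq> x"
  obtains f g w where "f \<in> AutQ" and "g \<in> AutQ"
    and "\<And>a. a \<in> E \<Longrightarrow> f a = f0 a \<and> g a = g0 a"
    and "\<And>y. y \<in> F \<Longrightarrow> ev f g w y = y" and "ev f1 g1 w x \<noteq> x"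
proof -
  define A where "A = E \<union> F \<union> f0 ` E \<union> g0 ` E"
  have finA: "finite A" using assms by (simp add: A_def)
  \<comment> \<open>\<open>lo\<close> and \<open>hi\<close> enclose all arguments, values and points
    of \<open>F\<close>, so making them common fixed points is compatible with the given data.
    Inserting 0 ensures \<open>lo < hi\<close> even if \<open>A\<close> is empty.\<close>
  define lo where "lo = Min (insert 0 A) - 1"
  define hi where "hi = Max (insert 0 A) + 1"
  have A: "lo < a \<and> a < hi" if "a \<in> insert 0 A" for a
  proof -
    have "Min (insert 0 A) \<le> a" "a \<le> Max (insert 0 A)"
      using that finA by (auto intro: Min_le Max_ge simp del: Min_insert Max_insert)
    then show ?thesis unfolding lo_def hi_def by linarith
  qed
  define D where "D = insert lo (insert hi E)"
  define ends where "ends h a = (if a = lo \<or> a = hi then a else h a)" for h :: "rat \<Rightarrow> rat" and a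
  have lohi: "lo < hi" using A[of 0] by auto
  have E: "lo < a \<and> a < hi \<and> lo < f0 a \<and> f0 a < hi \<and> lo < g0 a \<and> g0 a < hi" if "a \<in> E" for a
    using A[of a] A[of "f0 a"] A[of "g0 a"] that unfolding A_def by auto
  have mono: "strict_mono_on D (ends f0)" "strict_mono_on D (ends g0)"
    unfolding strict_mono_on_def D_def ends_def using E lohi f0 g0
    by (auto dest: order.asym)
  define C where "C = {c \<in> D. ends f0 c = c \<and> ends g0 c = c}"
  obtain f g where fg: "\<And>d. d \<in> D \<Longrightarrow> f d = ends f0 d" "\<And>d. d \<in> D \<Longrightarrow> g d = ends g0 d"
      "pushing_pair f g C lo hi"
    using exists_pushing_pair[of D lo hi "ends f0" "ends g0"] mono E lohi assms(3)
    unfolding C_def D_def ends_def by force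
  interpret pushing_pair f g C lo hi by (rule fg(3))
  have F: "F \<subseteq> {lo<..<hi}" using A by (auto simp: A_def)
  have endsE: "ends h a = h a" if "a \<in> E" for h a using E[OF that] by (auto simp: ends_def)
  have fgE: "f a = f0 a" "g a = g0 a" if "a \<in> E" for a
    using that fg endsE by (auto simp: D_def)
  obtain g' g'' w where G: "g' \<in> AutQ" "g'' \<in> AutQ"
      "\<And>a. a \<in> D \<Longrightarrow> g' a = g a" "\<And>a. a \<in> D \<Longrightarrow> g'' a = g a"
      "\<And>x. x \<in> F \<Longrightarrow> g' (ev f g' w x) = ev f g' w x"
      "\<And>x. x \<in> F \<Longrightarrow> g'' (f (ev f g'' w x)) = ev f g'' w x"
    using two_liberations[of D F] F assms(3,4) unfolding C_def D_def by auto
  let ?y = "ev f1 g1 w x"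
  let ?w' = "word_inv w @ [(False, True)] @ w"
  let ?w'' = "word_inv w @ [(False, True), (True, True)] @ w"
  have inj: "ev f1 g1 (word_inv w) z = x \<Longrightarrow> z = ?y" for z
    using ev_word_inv[OF f1 g1] AutQ_eq[OF ev_AutQ[OF f1 g1]] by metis
  show thesis
  proof (cases "g1 ?y = ?y")
    case False
    show thesis
    proof (rule that[of f g' ?w'])
      show "ev f1 g1 ?w' x \<noteq> x" using False inj by (auto simp: ev_append)
      show "ev f g' ?w' y = y" if "y \<in> F" for y
        using G(5)[OF that] ev_word_inv[OF f G(1)] by (simp add: ev_append)
    qed (use f G fgE in \<open>auto simp: D_def\<close>)
  next
    case True
    have "f1 ?y \<noteq> ?y"
    proof
      assume "f1 ?y = ?y"
      \<comment> \<open>The inverse of \<open>w\<close> fixes the common fixed point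
        \<open>?y\<close>, but it also takes \<open>?y\<close> back to \<open>x\<close>.\<close>
      then have "?y = x" using True ev_fixed[OF f1 g1, of ?y "word_inv w"] ev_word_inv[OF f1 g1, of w x] by simp
      then show False using moved True \<open>f1 ?y = ?y\<close> by simp
    qed
    then have ne: "g1 (f1 ?y) \<noteq> ?y" using True g1 by (metis AutQ_eq)
    show thesis
    proof (rule that[of f g'' ?w''])
      show "ev f1 g1 ?w'' x \<noteq> x" using ne inj by (auto simp: ev_append)
      show "ev f g'' ?w'' y = y" if "y \<in> F" for y
        using G(6)[OF that] ev_word_inv[OF f G(2)] by (simp add: ev_append)
    qed (use f G fgE in \<open>auto simp: D_def\<close>)
  qed
qed

section \<open>The topology and topological similarity\<close>

lemma openin_AutQ_top_agree:
  assumes "h \<in> AutQ" "finite E"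
  shows "openin AutQ_top {h' \<in> AutQ. \<forall>a\<in>E. h' a = h a}"
proof -
  have eq: "basic_open ((\<lambda>a. (a, h a)) ` E) = {h' \<in> AutQ. \<forall>a\<in>E. h' a = h a}"
    by (auto simp: basic_open_def)
  have "finite_partial_iso ((\<lambda>a. (a, h a)) ` E)"
    using assms by (auto simp: finite_partial_iso_def)
  then show ?thesis
    unfolding eq[symmetric] AutQ_top_def by (intro topology_generated_by_Basis) auto
qed

text \<open>Induction on the generation of the topology; an intersection of two open sets is handled
  by the union of the two finite sets.\<close>

lemma openin_AutQ_topD:
  assumes "openin AutQ_top W" and "h \<in> W"
  shows "\<exists>E. finite E \<and> {h' \<in> AutQ. \<forall>a\<in>E. h' a = h a} \<subseteq> W"
proof -
  have "generate_topology_on {basic_open p | p. finite_partial_iso p} W"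
    using assms(1) by (simp add: AutQ_top_def openin_topology_generated_by_iff)
  then show ?thesis using assms(2)
  proof (induction arbitrary: h)
    case (Int a b)
    then obtain E E' where "finite E" "{h' \<in> AutQ. \<forall>x\<in>E. h' x = h x} \<subseteq> a"
      "finite E'" "{h' \<in> AutQ. \<forall>x\<in>E'. h' x = h x} \<subseteq> b" by (meson IntD1 IntD2)
    then show ?case by (intro exI[of _ "E \<union> E'"]) auto
  next
    case (UN K)
    then show ?case by (meson Union_iff Sup_upper subset_trans)
  next
    case (Basis s)
    then obtain p where p: "s = basic_open p" "finite p"
      by (auto simp: finite_partial_iso_def)
    have "{h' \<in> AutQ. \<forall>a\<in>fst ` p. h' a = h a} \<subseteq> s"
      using Basis(2) unfolding p(1) basic_open_def by force
    then show ?case using p(2) by blast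
  qed simp
qed

lemma topspace_AutQ_top [simp]: "topspace AutQ_top = AutQ"
proof
  show "topspace AutQ_top \<subseteq> AutQ"
    by (auto simp: AutQ_top_def basic_open_def)
  show "AutQ \<subseteq> topspace AutQ_top"
    using openin_subset[OF openin_AutQ_top_agree[OF AutQ_id, of "{}"]] by simp
qed

text \<open>Agreement on finite sets gives a base of the product, so it suffices that each basic box
  contains a point with a box around it that misses \<open>N\<close>; one finite set serves both
  coordinates.\<close>

lemma nowhere_dense_in_AutQ2:
  assumes "N \<subseteq> AutQ \<times> AutQ"
    and dense: "\<And>f g E. f \<in> AutQ \<Longrightarrow> g \<in> AutQ \<Longrightarrow> finite E \<Longrightarrow> \<exists>f'\<in>AutQ. \<exists>g'\<in>AutQ. \<exists>E'.
      finite E' \<and> (\<forall>a\<in>E. f' a = f a \<and> g' a = g a) \<and>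
      (\<forall>f''\<in>AutQ. \<forall>g''\<in>AutQ. (\<forall>a\<in>E'. f'' a = f' a \<and> g'' a = g' a) \<longrightarrow> (f'', g'') \<notin> N)"
  shows "nowhere_dense_in (prod_topology AutQ_top AutQ_top) N"
proof -
  let ?X = "prod_topology AutQ_top AutQ_top"
  have False if p_in: "p \<in> ?X interior_of (?X closure_of N)" for p
  proof -
    obtain f g where p: "p = (f, g)" by fastforce
    obtain U V where U: "openin AutQ_top U" "f \<in> U" and V: "openin AutQ_top V" "g \<in> V"
      and UV: "U \<times> V \<subseteq> ?X closure_of N"
    proof -
      obtain T where "openin ?X T" "(f, g) \<in> T" "T \<subseteq> ?X closure_of N"
        using p_in unfolding p interior_of_def by auto
      moreover from this obtain U V where "openin AutQ_top U" "f \<in> U" "openin AutQ_top V" "g \<in> V"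
          "U \<times> V \<subseteq> T"
        unfolding openin_prod_topology_alt by metis
      ultimately show ?thesis using that by simp
    qed
    obtain E1 where E1: "finite E1" "{h \<in> AutQ. \<forall>a\<in>E1. h a = f a} \<subseteq> U"
      using openin_AutQ_topD U by blast
    obtain E2 where E2: "finite E2" "{h \<in> AutQ. \<forall>a\<in>E2. h a = g a} \<subseteq> V"
      using openin_AutQ_topD V by blast
    have fgE: "f \<in> AutQ" "g \<in> AutQ" "finite (E1 \<union> E2)"
      using U V E1 E2 openin_subset[of AutQ_top] by auto
    obtain f' g' E' where f': "f' \<in> AutQ" "g' \<in> AutQ" "finite E'"
        "\<forall>a\<in>E1 \<union> E2. f' a = f a \<and> g' a = g a"
        "\<forall>f''\<in>AutQ. \<forall>g''\<in>AutQ. (\<forall>a\<in>E'. f'' a = f' a \<and> g'' a = g' a) \<longrightarrow> (f'', g'') \<notin> N"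
      using dense[OF fgE] by (elim bexE exE conjE)
    have "f' \<in> U" "g' \<in> V" using f' E1(2) E2(2) by auto
    then have cl: "(f', g') \<in> ?X closure_of N" using UV by auto
    let ?W = "{h \<in> AutQ. \<forall>a\<in>E'. h a = f' a} \<times> {h \<in> AutQ. \<forall>a\<in>E'. h a = g' a}"
    have op: "openin ?X ?W"
      using openin_AutQ_top_agree f' by (simp add: openin_prod_Times_iff)
    have "(f', g') \<in> ?W" using f' by simp
    with cl op obtain q where "q \<in> N" "q \<in> ?W" unfolding in_closure_of by meson
    then show False using f'(5) by (cases q) simp
  qed
  then show ?thesis using assms(1) by (auto simp: nowhere_dense_in_def)
qed

section \<open>The generated subgroup in terms of words\<close>

lemma group_AutQ: "group AutQ_group"
proof (rule groupI)
  fix x assume "x \<in> carrier AutQ_group"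
  then have x: "x \<in> AutQ" by (simp add: AutQ_group_def)
  then have "qinv x \<circ> x = id" by auto
  then show "\<exists>y\<in>carrier AutQ_group. y \<otimes>\<^bsub>AutQ_group\<^esub> x = \<one>\<^bsub>AutQ_group\<^esub>"
    using AutQ_inv[OF x] by (auto simp: AutQ_group_def)
qed (auto simp: AutQ_group_def AutQ_id AutQ_comp comp_assoc)

lemma m_inv_AutQ:
  assumes "h \<in> AutQ"
  shows "inv\<^bsub>AutQ_group\<^esub> h = qinv h"
proof -
  interpret group AutQ_group by (rule group_AutQ)
  have "qinv h \<circ> h = id" using assms by auto
  then show ?thesis
    using inv_equality[of "qinv h" h] assms AutQ_inv[OF assms] by (simp add: AutQ_group_def)
qed

lemma letter_in_generate:
  assumes "f \<in> AutQ" "g \<in> AutQ"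
  shows "letter f g l \<in> generate AutQ_group {f, g}"
proof -
  have "f \<in> generate AutQ_group {f, g}" "g \<in> generate AutQ_group {f, g}"
    by (auto intro: generate.incl)
  moreover have "qinv f \<in> generate AutQ_group {f, g}" "qinv g \<in> generate AutQ_group {f, g}"
    using generate.inv[of f "{f, g}" AutQ_group] generate.inv[of g "{f, g}" AutQ_group]
    by (simp_all add: m_inv_AutQ assms)
  ultimately show ?thesis by (cases l) (auto simp: Let_def)
qed

lemma ev_in_generate:
  assumes "f \<in> AutQ" "g \<in> AutQ"
  shows "ev f g w \<in> generate AutQ_group {f, g}"
proof (induction w)
  case Nil
  have "\<one>\<^bsub>AutQ_group\<^esub> = id" by (simp add: AutQ_group_def)
  then show ?case using generate.one[of AutQ_group "{f, g}"] unfolding ev.simps by metis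
next
  case (Cons l w)
  then show ?case
    using generate.eng[OF letter_in_generate[OF assms, of l] Cons]
    unfolding ev.simps by (simp add: AutQ_group_def del: o_apply)
qed

text \<open>A homomorphism that matches the generators matches their inverses, hence all letters and
  all words.\<close>

lemma top_similar_ev:
  assumes AutQ: "f \<in> AutQ" "g \<in> AutQ" "f1 \<in> AutQ" "g1 \<in> AutQ"
    and sim: "top_similar (f, g) (f1, g1)"
  obtains \<phi> where "\<And>w. \<phi> (ev f g w) = ev f1 g1 w"
    and "inj_on \<phi> (generate AutQ_group {f, g})"
    and "homeomorphic_map (subtopology AutQ_top (generate AutQ_group {f, g}))
           (subtopology AutQ_top (generate AutQ_group {f1, g1})) \<phi>"
proof -
  let ?H = "generate AutQ_group {f, g}"
  let ?H1 = "generate AutQ_group {f1, g1}"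
  obtain \<phi> where \<phi>: "\<phi> \<in> iso (AutQ_group\<lparr>carrier := ?H\<rparr>) (AutQ_group\<lparr>carrier := ?H1\<rparr>)"
      "\<phi> f = f1" "\<phi> g = g1" "homeomorphic_map (subtopology AutQ_top ?H) (subtopology AutQ_top ?H1) \<phi>"
    using sim unfolding top_similar_def Let_def fst_conv snd_conv by blast
  have hom: "\<phi> (a \<circ> b) = \<phi> a \<circ> \<phi> b" if "a \<in> ?H" "b \<in> ?H" for a b
    using \<phi>(1) that by (auto simp: iso_def hom_def AutQ_group_def)
  have inj: "inj_on \<phi> ?H" using \<phi>(1) by (auto simp: iso_def bij_betw_def)
  have ran: "\<phi> a \<in> AutQ" if "a \<in> ?H" for a
  proof -
    have "\<phi> a \<in> ?H1" using \<phi>(1) that by (auto simp: iso_def hom_def)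
    moreover have "?H1 \<subseteq> carrier AutQ_group"
      using group.generate_incl[OF group_AutQ, of "{f1, g1}"] AutQ by (auto simp: AutQ_group_def)
    ultimately show ?thesis by (auto simp: AutQ_group_def)
  qed
  have idH: "id \<in> ?H" using ev_in_generate[OF AutQ(1,2), of "[]"] by simp
  have \<phi>id: "\<phi> id = id"
  proof
    fix x
    \<comment> \<open>\<open>\<phi> id\<close> is idempotent, and an injective idempotent map is the
      identity.\<close>
    have "\<phi> id (\<phi> id x) = \<phi> id x" using hom[OF idH idH] by (metis comp_id comp_apply)
    then show "\<phi> id x = id x" using ran[OF idH] by simp
  qed
  have \<phi>inv: "\<phi> (qinv h) = qinv (\<phi> h)" if "h \<in> ?H" "qinv h \<in> ?H" "h \<in> AutQ" for h
  proof
    fix x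
    have "h \<circ> qinv h = id" using that(3) by auto
    then have "\<phi> h \<circ> \<phi> (qinv h) = id" using hom[OF that(1,2)] \<phi>id by simp
    then have "\<phi> h (\<phi> (qinv h) x) = x" by (metis comp_apply id_apply)
    then show "\<phi> (qinv h) x = qinv (\<phi> h) x" using ran[OF that(1)] AutQ_inv_f by metis
  qed
  have let_eq: "\<phi> (letter f g l) = letter f1 g1 l" for l
  proof -
    have in_H: "letter f g (b, s) \<in> ?H" for b s using letter_in_generate[OF AutQ(1,2)] by blast
    have "f \<in> ?H" "g \<in> ?H" "qinv f \<in> ?H" "qinv g \<in> ?H"
      using in_H[of True True] in_H[of False True] in_H[of True False] in_H[of False False] by auto
    then show ?thesis using \<phi>inv[of f] \<phi>inv[of g] AutQ \<phi>(2,3) by (cases l) (auto simp: Let_def)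
  qed
  have "\<phi> (ev f g w) = ev f1 g1 w" for w
  proof (induction w)
    case (Cons l w)
    then show ?case
      unfolding ev.simps hom[OF letter_in_generate[OF AutQ(1,2)] ev_in_generate[OF AutQ(1,2)]] let_eq
      by simp
  qed (unfold ev.simps, rule \<phi>id)
  then show thesis using that inj \<phi>(4) by blast
qed

text \<open>By continuity at the identity, the preimage under \<open>\<phi>\<close> of the
  stabilizer of \<open>x\<close> is a neighbourhood of \<open>id\<close> in the generated group; it
  thus contains the pointwise stabilizer of some finite \<open>F\<close>.\<close>

lemma top_similar_fixes:
  assumes AutQ: "f \<in> AutQ" "g \<in> AutQ" "f1 \<in> AutQ" "g1 \<in> AutQ"
    and sim: "top_similar (f, g) (f1, g1)"
  obtains F where "finite F" and "\<And>w. (\<forall>y\<in>F. ev f g w y = y) \<Longrightarrow> ev f1 g1 w x = x"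
proof -
  let ?H = "generate AutQ_group {f, g}"
  let ?H1 = "generate AutQ_group {f1, g1}"
  let ?S = "subtopology AutQ_top ?H"
  let ?S1 = "subtopology AutQ_top ?H1"
  obtain \<phi> where \<phi>: "\<And>w. \<phi> (ev f g w) = ev f1 g1 w" "homeomorphic_map ?S ?S1 \<phi>"
    using top_similar_ev[OF assms] by metis
  let ?V = "{h \<in> AutQ. \<forall>a\<in>{x}. h a = id a}"
  have "openin AutQ_top ?V"
    by (rule openin_AutQ_top_agree[OF AutQ_id]) simp
  then have "openin ?S1 (?H1 \<inter> ?V)" by (rule openin_subtopology_Int2)
  then have "openin ?S {h \<in> topspace ?S. \<phi> h \<in> ?H1 \<inter> ?V}"
    using homeomorphic_imp_continuous_map[OF \<phi>(2)] openin_continuous_map_preimage by blast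
  then obtain W where W: "openin AutQ_top W" "{h \<in> topspace ?S. \<phi> h \<in> ?H1 \<inter> ?V} = W \<inter> ?H"
    by (auto simp: openin_subtopology)
  have in_H: "ev f g w \<in> ?H" "ev f1 g1 w \<in> ?H1" for w using ev_in_generate AutQ by auto
  have "\<phi> id = id" using \<phi>(1)[of "[]"] by simp
  moreover have "id \<in> ?H" "id \<in> ?H1" using in_H[of "[]"] unfolding ev.simps .
  ultimately have "id \<in> {h \<in> topspace ?S. \<phi> h \<in> ?H1 \<inter> ?V}" by (simp add: AutQ_id)
  then have "id \<in> W" unfolding W(2) by (rule IntD1)
  then obtain F where F: "finite F" "{h \<in> AutQ. \<forall>y\<in>F. h y = id y} \<subseteq> W"
    using openin_AutQ_topD[OF W(1)] by blast
  show thesis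
  proof (rule that[OF F(1)])
    fix w assume "\<forall>y\<in>F. ev f g w y = y"
    then have "ev f g w \<in> {h \<in> AutQ. \<forall>y\<in>F. h y = id y}" using ev_AutQ AutQ by simp
    then have "ev f g w \<in> W \<inter> ?H" using F(2) in_H by blast
    then have "\<phi> (ev f g w) \<in> ?V" unfolding W(2)[symmetric] by simp
    then show "ev f1 g1 w x = x" using \<phi>(1) by simp
  qed
qed

text \<open>At \<open>(id, id)\<close> the one-letter word and the empty word agree, so injectivity
  of \<open>\<phi>\<close> makes them agree at \<open>(f, g)\<close>. This settles the class of the
  trivial pair, where no moved \<open>x\<close> exists.\<close>

lemma top_similar_id:
  assumes "f \<in> AutQ" "g \<in> AutQ" and sim: "top_similar (f, g) (id, id)"
  shows "f = id"
proof -
  obtain \<phi> where \<phi>: "\<And>w. \<phi> (ev f g w) = ev id id w" "inj_on \<phi> (generate AutQ_group {f, g})"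
    using top_similar_ev[OF assms(1,2) AutQ_id AutQ_id sim] by metis
  have "\<phi> (ev f g [(True, True)]) = \<phi> (ev f g [])" unfolding \<phi>(1) by simp
  then have "ev f g [(True, True)] = ev f g []"
    using inj_onD[OF \<phi>(2)] ev_in_generate[OF assms(1,2)] by blast
  then show ?thesis by simp
qed

theorem theorem3p13:
  assumes "f1 \<in> AutQ" and "g1 \<in> AutQ"
  shows "meager_in (prod_topology AutQ_top AutQ_top)
           {(f, g). f \<in> AutQ \<and> g \<in> AutQ \<and> top_similar (f, g) (f1, g1)}"
proof (cases "f1 = id \<and> g1 = id")
  case True
  let ?N = "{id} \<times> AutQ"
  have "nowhere_dense_in (prod_topology AutQ_top AutQ_top) ?N"
  proof (rule nowhere_dense_in_AutQ2)
    fix f g :: "rat \<Rightarrow> rat" and E :: "rat set"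
    assume fgE: "f \<in> AutQ" "g \<in> AutQ" "finite E"
    obtain z where z: "z \<notin> E" using fgE(3) ex_new_if_finite infinite_UNIV_char_0 by blast
    obtain h where h: "h \<in> AutQ" "\<And>a. a \<in> E \<Longrightarrow> h a = f a" "h z \<noteq> f z"
      using AutQ_perturb[OF fgE(1,3) z] by blast
    \<comment> \<open>\<open>f'\<close> agrees with \<open>f\<close> on \<open>E\<close> and moves
      \<open>z\<close> in either case; the value at \<open>z\<close> alone then keeps a
      neighbourhood away from \<open>id\<close>.\<close>
    define f' where "f' = (if f z = z then h else f)"
    have "f' \<in> AutQ" "\<forall>a\<in>E. f' a = f a" "f' z \<noteq> z" using h fgE by (auto simp: f'_def)
    then show "\<exists>f'\<in>AutQ. \<exists>g'\<in>AutQ. \<exists>E'. finite E' \<and> (\<forall>a\<in>E. f' a = f a \<and> g' a = g a) \<and>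
      (\<forall>f''\<in>AutQ. \<forall>g''\<in>AutQ. (\<forall>a\<in>E'. f'' a = f' a \<and> g'' a = g' a) \<longrightarrow> (f'', g'') \<notin> ?N)"
      using fgE by (intro bexI[of _ f'] bexI[of _ g] exI[of _ "{z}"]) auto
  qed (auto simp: AutQ_id)
  then show ?thesis unfolding meager_in_def
    using True top_similar_id by (intro conjI exI[of _ "{?N}"]) auto
next
  case False
  then obtain x where x: "f1 x \<noteq> x \<or> g1 x \<noteq> x" by (metis ext id_apply)
  \<comment> \<open>The finite sets \<open>F\<close> of rationals are countably many, and the class
    is covered by the sets \<open>N F\<close>. The word that excludes a pair from \<open>N F\<close>
    reads finitely many values, so it excludes a whole neighbourhood.\<close>
  define N where "N F = {(f, g). f \<in> AutQ \<and> g \<in> AutQ \<and>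
      (\<forall>w. (\<forall>y\<in>F. ev f g w y = y) \<longrightarrow> ev f1 g1 w x = x)}" for F
  have "nowhere_dense_in (prod_topology AutQ_top AutQ_top) (N F)" if F: "finite F" for F
  proof (rule nowhere_dense_in_AutQ2)
    fix f g :: "rat \<Rightarrow> rat" and E :: "rat set"
    assume fgE: "f \<in> AutQ" "g \<in> AutQ" "finite E"
    obtain f' g' w where f': "f' \<in> AutQ" "g' \<in> AutQ"
        "\<And>a. a \<in> E \<Longrightarrow> f' a = f a \<and> g' a = g a"
        "\<And>y. y \<in> F \<Longrightarrow> ev f' g' w y = y" "ev f1 g1 w x \<noteq> x"
      using word_fixing_finite_set[OF fgE F assms x] by metis
    obtain E' where E': "finite E'" "\<And>f'' g'' y. f'' \<in> AutQ \<Longrightarrow> g'' \<in> AutQ \<Longrightarrow>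
        (\<forall>a\<in>E'. f'' a = f' a \<and> g'' a = g' a) \<Longrightarrow> y \<in> F \<Longrightarrow> ev f'' g'' w y = ev f' g' w y"
      using ev_support[OF f'(1,2) F] by metis
    have "(f'', g'') \<notin> N F" if "f'' \<in> AutQ" "g'' \<in> AutQ"
        "\<forall>a\<in>E'. f'' a = f' a \<and> g'' a = g' a" for f'' g''
      using E'(2)[OF that] f'(4,5) unfolding N_def by auto
    then show "\<exists>f'\<in>AutQ. \<exists>g'\<in>AutQ. \<exists>E'. finite E' \<and> (\<forall>a\<in>E. f' a = f a \<and> g' a = g a) \<and>
      (\<forall>f''\<in>AutQ. \<forall>g''\<in>AutQ. (\<forall>a\<in>E'. f'' a = f' a \<and> g'' a = g' a) \<longrightarrow> (f'', g'') \<notin> N F)"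
      using f' E'(1) by blast
  qed (auto simp: N_def)
  moreover have "{(f, g). f \<in> AutQ \<and> g \<in> AutQ \<and> top_similar (f, g) (f1, g1)} \<subseteq> \<Union> (N ` {F. finite F})"
  proof safe
    fix f g assume fg: "f \<in> AutQ" "g \<in> AutQ" "top_similar (f, g) (f1, g1)"
    obtain F where "finite F" "\<And>w. (\<forall>y\<in>F. ev f g w y = y) \<Longrightarrow> ev f1 g1 w x = x"
      using top_similar_fixes[OF fg(1,2) assms fg(3)] by metis
    then have "(f, g) \<in> N F" "F \<in> {F. finite F}" using fg unfolding N_def by auto
    then show "(f, g) \<in> \<Union> (N ` {F. finite F})" by blast
  qed
  moreover have "countable (N ` {F. finite F})"
    using countable_Collect_finite by blast
  ultimately show ?thesis unfolding meager_in_def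
    by (intro conjI exI[of _ "N ` {F. finite F}"]) auto
qed

end
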